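(* Let $d\ge 2$ and let $X_1,\ldots,X_d$ be i.i.d. jumps with cdf $F\in\mathcal{L}(\theta)$, $\theta>0$. Suppose that the following assumption (Assumption A) holds: if $h$ is a long-tailed function such that $h(x)>0$ for all $x\ge 0$, then $$G(\gamma):=\sup\Big\{\frac{h(\gamma)}{h(x)}:0\le x\le\gamma\Big\}=o(e^{\epsilon\gamma})\quad(\gamma\to\infty)\qquad\text{for all }\epsilon>0.$$ Then the estimator $Z=\mathbb{I}\{S(\mathbf{X})>\gamma\}\frac{f(\mathbf{X})}{g(\mathbf{X})}$, $\mathbf{X}\sim g$, of $\ell(\gamma)=\mathbb{P}(X_1+\cdots+X_d>\gamma)$ is logarithmically efficient, that is, $$\lim_{\gamma\to\infty}\frac{\mathbb{E}Z^2}{\ell^{2-\epsilon}(\gamma)}=0\qquad\text{for all }\epsilon>0.$$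
   Context: The jumps are positive continuous i.i.d. random variables with right-unbounded support, cdf $F$, density $f_1$, tail $\overline F=1-F$; $F^{*k}$ is the $k$-fold convolution of $F$ and $\overline{F^{*k}}=1-F^{*k}$ (equal to $1$ on negative arguments). For $\theta\ge 0$, $\mathcal{L}(\theta)$ is the (Embrechts–Goldie) class of distributions $F$ with $\lim_{\gamma\to\infty}\overline F(\gamma+x)/\overline F(\gamma)=e^{-\theta x}$ for all $x$. A function $h$ is long-tailed if it is ultimately positive and $\lim_{\gamma\to\infty}h(\gamma+x)/h(\gamma)=1$ for all $x$. Write $f(\mathbf{x})=\prod_{i=1}^d f_1(x_i)$, $S(\mathbf{x})=x_1+\cdots+x_d$, $\ell(\gamma)=\overline{F^{*d}}(\gamma)$. The importance sampling density is $g(\mathbf{x})=\prod_{i=1}^d\pi_i(x_i)$ with $$\pi_i(x)=\frac{f_1(x)\,\overline{F^{*(d-1)}}(\gamma-x)}{\overline{F^{*d}}(\gamma)}$$ (the marginals of the density $\mathbb{I}\{S(\mathbf{x})>\gamma\}f(\mathbf{x})/\ell(\gamma)$), so that $$Z=\mathbb{I}\{S(\mathbf{X})>\gamma\}\prod_{i=1}^d\frac{\overline{F^{*d}}(\gamma)}{\overline{F^{*(d-1)}}(\gamma-X_i)}.$$ $\mathbb{E}Z^2$ is taken with $\mathbf{X}\sim g$. *)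

theory Defs
  imports "HOL-Probability.Probability" "HOL-Library.Landau_Symbols"
begin

definition tail :: "real measure \<Rightarrow> real \<Rightarrow> real" where
  "tail N x = 1 - cdf N x"

definition jump_law :: "(real \<Rightarrow> real) \<Rightarrow> real measure" where
  "jump_law f1 = density lborel (\<lambda>x. ennreal (f1 x))"

primrec conv_power :: "nat \<Rightarrow> real measure \<Rightarrow> real measure" where
  "conv_power 0 N = return borel 0"
| "conv_power (Suc k) N = convolution N (conv_power k N)"

definition embrechts_goldie :: "real \<Rightarrow> real measure \<Rightarrow> bool" where
  "embrechts_goldie \<theta> N \<longleftrightarrow>
     (\<forall>x. ((\<lambda>\<gamma>. tail N (\<gamma> + x) / tail N \<gamma>) \<longlongrightarrow> exp (- \<theta> * x)) at_top)"

definition long_tailed :: "(real \<Rightarrow> real) \<Rightarrow> bool" where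
  "long_tailed h \<longleftrightarrow>
     (\<forall>\<^sub>F x in at_top. h x > 0) \<and> (\<forall>x. ((\<lambda>\<gamma>. h (\<gamma> + x) / h \<gamma>) \<longlongrightarrow> 1) at_top)"

(* The supremum is taken in the reals, so its value is meaningful only when the
   set of quotients is bounded above; users must assume this separately. *)
definition sup_ratio :: "(real \<Rightarrow> real) \<Rightarrow> real \<Rightarrow> real" where
  "sup_ratio h \<gamma> = (SUP x\<in>{0..\<gamma>}. h \<gamma> / h x)"

definition is_marginal :: "(real \<Rightarrow> real) \<Rightarrow> nat \<Rightarrow> real \<Rightarrow> real \<Rightarrow> real" where
  "is_marginal f1 d \<gamma> x =
     f1 x * tail (conv_power (d - 1) (jump_law f1)) (\<gamma> - x) / tail (conv_power d (jump_law f1)) \<gamma>"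

(* Vectors in d-dimensional space are functions on the index set {..<d}. *)
definition is_density :: "(real \<Rightarrow> real) \<Rightarrow> nat \<Rightarrow> real \<Rightarrow> (nat \<Rightarrow> real) \<Rightarrow> real" where
  "is_density f1 d \<gamma> x = (\<Prod>i<d. is_marginal f1 d \<gamma> (x i))"

definition is_law :: "(real \<Rightarrow> real) \<Rightarrow> nat \<Rightarrow> real \<Rightarrow> (nat \<Rightarrow> real) measure" where
  "is_law f1 d \<gamma> =
     density (\<Pi>\<^sub>M i\<in>{..<d}. lborel) (\<lambda>x. ennreal (is_density f1 d \<gamma> x))"

(* The value 0 at points where the sampling density vanishes is immaterial:
   these points form a null set of the sampling law. *)
definition is_estimator :: "(real \<Rightarrow> real) \<Rightarrow> nat \<Rightarrow> real \<Rightarrow> (nat \<Rightarrow> real) \<Rightarrow> real" where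
  "is_estimator f1 d \<gamma> x =
     (if (\<Sum>i<d. x i) > \<gamma> then (\<Prod>i<d. f1 (x i)) / is_density f1 d \<gamma> x else 0)"

(* Extended nonnegative expectation: a Bochner integral would be 0 for a
   non-integrable square. *)
definition is_second_moment :: "(real \<Rightarrow> real) \<Rightarrow> nat \<Rightarrow> real \<Rightarrow> ennreal" where
  "is_second_moment f1 d \<gamma> =
     (\<integral>\<^sup>+ x. ennreal ((is_estimator f1 d \<gamma> x)\<^sup>2) \<partial>is_law f1 d \<gamma>)"

end

theory Submission
  imports Defs "HOL-Real_Asymp.Real_Asymp"
begin

text \<open>Integrating against the sampling law turns \<open>Z\<^sup>2 g\<close> into \<open>Z f\<close>, so the second moment is the
  mean of \<open>Z\<close> under the original law. For positive jumps with sum exceeding \<open>\<gamma>\<close> one has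
  \<open>\<Sum>(\<gamma> - X\<^sub>i)\<^sup>+ \<le> (d - 1) \<gamma>\<close>, and the tail of a \<open>(d - 1)\<close>-fold sum dominates that of a single
  jump, which is at least \<open>c exp (- (\<theta> + \<delta>) x)\<close>; hence the second moment is at most
  \<open>c\<^sup>-\<^sup>d \<ell>(\<gamma>)\<^sup>d\<^sup>+\<^sup>1 exp ((\<theta> + \<delta>) (d - 1) \<gamma>)\<close>. The Chernoff bound gives
  \<open>\<ell>(\<gamma>) \<le> B exp (- (\<theta> - \<delta>) \<gamma>)\<close>, so that after division by \<open>\<ell>(\<gamma>)\<^sup>2\<^sup>-\<^sup>\<epsilon>\<close> an exponentially small
  quantity remains once \<open>\<delta>\<close> is small compared with \<open>\<epsilon>\<close>.\<close>

section \<open>Exponential bounds from the ratio over unit steps\<close>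

text \<open>As \<open>s\<close> exceeds \<theta>, from some \<open>N\<close> on each unit step costs
  at most a factor \<open>exp (- s)\<close>. Iterating controls the points \<open>N + n\<close>, and
  monotonicity covers the rest.\<close>

lemma exponential_lower_bound:
  fixes T :: "real \<Rightarrow> real"
  assumes "antimono T" and pos: "\<And>x. T x > 0"
    and lim: "((\<lambda>x. T (x + 1) / T x) \<longlongrightarrow> exp (- \<theta>)) at_top"
    and "\<theta> < s" "0 < s"
  shows "\<exists>c>0. \<forall>x\<ge>0. c * exp (- s * x) \<le> T x"
proof -
  have "\<forall>\<^sub>F x in at_top. exp (- s) < T (x + 1) / T x"
    using lim by (rule order_tendstoD(1)) (use \<open>\<theta> < s\<close> in simp)
  then obtain N0 where N0: "\<And>x. x \<ge> N0 \<Longrightarrow> exp (- s) < T (x + 1) / T x"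
    by (auto simp: eventually_at_top_linorder)
  define N where "N = max N0 0"
  have step: "exp (- s) * T x \<le> T (x + 1)" if "x \<ge> N" for x
    using N0[of x] that pos[of x] by (simp add: N_def field_simps)
  have iter: "exp (- s * n) * T N \<le> T (N + real n)" for n :: nat
  proof (induction n)
    case (Suc n)
    have "exp (- s * Suc n) * T N = exp (- s) * (exp (- s * n) * T N)"
      by (simp add: algebra_simps flip: exp_add)
    also have "\<dots> \<le> exp (- s) * T (N + real n)"
      using Suc by simp
    also have "\<dots> \<le> T (N + real (Suc n))"
      using step[of "N + real n"] by (simp add: algebra_simps)
    finally show ?case .
  qed simp
  \<comment> \<open>Rounding \<open>x\<close> up to \<open>n\<close> costs the factor
    \<open>exp (- s)\<close>. Since \<open>N\<close> is nonnegative, \<open>N + n\<close> lies to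
    the right of \<open>x\<close>, the side on which the value of an antitone \<open>T\<close> is a
    lower bound.\<close>
  have "exp (- s) * T N * exp (- s * x) \<le> T x" if "x \<ge> 0" for x
  proof -
    define n where "n = nat \<lceil>x\<rceil>"
    have n: "x \<le> real n" "real n \<le> x + 1"
      using that unfolding n_def by linarith+
    have "exp (- s) * T N * exp (- s * x) = exp (- s * (x + 1)) * T N"
      by (simp add: algebra_simps flip: exp_add)
    also have "\<dots> \<le> exp (- s * n) * T N"
      using n \<open>0 < s\<close> pos[of N] by (intro mult_right_mono) auto
    also have "\<dots> \<le> T (N + real n)" by (rule iter)
    also have "\<dots> \<le> T x"
      using n by (intro antimonoD[OF \<open>antimono T\<close>]) (simp add: N_def)
    finally show ?thesis .
  qed
  moreover have "exp (- s) * T N > 0" using pos by simp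
  ultimately show ?thesis by blast
qed

text \<open>The mirror image: with \<open>s\<close> below \<theta>, each unit step beyond
  \<open>N\<close> gains at least the factor \<open>exp (- s)\<close>.\<close>

lemma exponential_upper_bound:
  fixes T :: "real \<Rightarrow> real"
  assumes "antimono T" and pos: "\<And>x. T x > 0"
    and lim: "((\<lambda>x. T (x + 1) / T x) \<longlongrightarrow> exp (- \<theta>)) at_top"
    and "s < \<theta>" "0 < s"
  shows "\<exists>C>0. \<forall>x\<ge>0. T x \<le> C * exp (- s * x)"
proof -
  have "\<forall>\<^sub>F x in at_top. T (x + 1) / T x < exp (- s)"
    using lim by (rule order_tendstoD(2)) (use \<open>s < \<theta>\<close> in simp)
  then obtain N0 where N0: "\<And>x. x \<ge> N0 \<Longrightarrow> T (x + 1) / T x < exp (- s)"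
    by (auto simp: eventually_at_top_linorder)
  define N where "N = max N0 0"
  have step: "T (x + 1) \<le> exp (- s) * T x" if "x \<ge> N" for x
    using N0[of x] that pos[of x] by (simp add: N_def field_simps)
  have iter: "T (N + real n) \<le> exp (- s * n) * T N" for n :: nat
  proof (induction n)
    case (Suc n)
    have "T (N + real (Suc n)) \<le> exp (- s) * T (N + real n)"
      using step[of "N + real n"] by (simp add: algebra_simps)
    also have "\<dots> \<le> exp (- s) * (exp (- s * n) * T N)"
      using Suc by simp
    also have "\<dots> = exp (- s * Suc n) * T N"
      by (simp add: algebra_simps flip: exp_add)
    finally show ?case .
  qed simp
  \<comment> \<open>In \<open>exp (s * (N + 1))\<close>, the \<open>N\<close> pays for the delayed
    start of the iteration and the \<open>1\<close> for rounding down. For \<open>x < N\<close> the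
    truncation by \<open>nat\<close> gives \<open>n = 0\<close>, and the intermediate bound reduces
    to \<open>T x \<le> T 0\<close>.\<close>
  have "T x \<le> exp (s * (N + 1)) * T 0 * exp (- s * x)" if "x \<ge> 0" for x
  proof -
    define n where "n = nat \<lfloor>x - N\<rfloor>"
    have n: "x - N - 1 \<le> real n"
      unfolding n_def by linarith
    have "T x \<le> exp (- s * n) * T 0"
    proof (cases "x \<ge> N")
      case True
      then have "N + real n \<le> x" unfolding n_def by linarith
      then have "T x \<le> T (N + real n)" by (rule antimonoD[OF \<open>antimono T\<close>])
      also have "\<dots> \<le> exp (- s * n) * T N" by (rule iter)
      also have "\<dots> \<le> exp (- s * n) * T 0"
        using antimonoD[OF \<open>antimono T\<close>, of 0 N] by (simp add: N_def)
      finally show ?thesis .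
    next
      case False
      then show ?thesis
        using antimonoD[OF \<open>antimono T\<close>, of 0 x] that by (simp add: n_def)
    qed
    also have "\<dots> \<le> exp (- s * (x - N - 1)) * T 0"
      using n \<open>0 < s\<close> pos[of 0] by (intro mult_right_mono) auto
    also have "\<dots> = exp (s * (N + 1)) * T 0 * exp (- s * x)"
      by (simp add: algebra_simps flip: exp_add)
    finally show ?thesis .
  qed
  moreover have "exp (s * (N + 1)) * T 0 > 0" using pos by simp
  ultimately show ?thesis by blast
qed

section \<open>Exponential moments and the Chernoff bound\<close>

text \<open>Slicing the range of \<open>Y\<close> into unit intervals bounds the moment by a series
  over the events \<open>Y > n\<close>. The tail bound makes it geometric with ratio
  \<open>exp (s - r) < 1\<close>.\<close>

lemma (in prob_space) exponential_moment_finite: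
  assumes Y[measurable]: "random_variable borel Y"
    and "AE \<omega> in M. Y \<omega> > 0"
    and tail: "\<And>x. x \<ge> 0 \<Longrightarrow> prob {\<omega> \<in> space M. Y \<omega> > x} \<le> C * exp (- r * x)"
    and "0 \<le> s" "s < r"
  shows "(\<integral>\<^sup>+ \<omega>. ennreal (exp (s * Y \<omega>)) \<partial>M) < \<infinity>"
proof -
  let ?I = "\<lambda>n \<omega>. ennreal (exp (s * (real n + 1))) * indicator {\<omega> \<in> space M. Y \<omega> > real n} \<omega>"
  have C: "0 \<le> C" using order_trans[OF measure_nonneg tail[of 0]] by simp
  have "(\<integral>\<^sup>+ \<omega>. ennreal (exp (s * Y \<omega>)) \<partial>M) \<le> (\<integral>\<^sup>+ \<omega>. (\<Sum>n. ?I n \<omega>) \<partial>M)"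
  proof (rule nn_integral_mono_AE, use assms(2) AE_space in eventually_elim)
    fix \<omega> assume pos: "Y \<omega> > 0" and sp: "\<omega> \<in> space M"
    \<comment> \<open>The ceiling minus one, not the floor: the event \<open>Y > n\<close> is
      strict, so an integer value of \<open>Y\<close> must fall into the slice below it.\<close>
    define n where "n = nat (\<lceil>Y \<omega>\<rceil> - 1)"
    have n: "real n < Y \<omega>" "Y \<omega> \<le> real n + 1"
      using pos unfolding n_def by linarith+
    have "ennreal (exp (s * Y \<omega>)) \<le> ?I n \<omega>"
      using n sp \<open>0 \<le> s\<close> by (auto intro!: ennreal_leI mult_left_mono)
    also have "\<dots> \<le> (\<Sum>n. ?I n \<omega>)"
      using sum_le_suminf[of "\<lambda>n. ?I n \<omega>" "{n}"]
      by (simp del: sum_mult_indicator)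
    finally show "ennreal (exp (s * Y \<omega>)) \<le> (\<Sum>n. ?I n \<omega>)" .
  qed
  also have "\<dots> = (\<Sum>n. ennreal (exp (s * (real n + 1))) * emeasure M {\<omega> \<in> space M. Y \<omega> > real n})"
    by (simp add: nn_integral_suminf nn_integral_cmult)
  also have "\<dots> \<le> (\<Sum>n. ennreal (C * exp s * exp (s - r) ^ n))"
  proof (rule suminf_le)
    fix n
    have "exp (s * (real n + 1)) * prob {\<omega> \<in> space M. Y \<omega> > real n}
        \<le> exp (s * (real n + 1)) * (C * exp (- r * real n))"
      using tail[of "real n"] by (intro mult_left_mono) auto
    also have "\<dots> = C * exp s * exp (s - r) ^ n"
      by (simp add: algebra_simps flip: exp_add exp_of_nat_mult)
    finally show "ennreal (exp (s * (real n + 1))) * emeasure M {\<omega> \<in> space M. Y \<omega> > real n}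
        \<le> ennreal (C * exp s * exp (s - r) ^ n)"
      by (simp add: emeasure_eq_measure ennreal_leI flip: ennreal_mult)
  qed auto
  also have "\<dots> = ennreal (\<Sum>n. C * exp s * exp (s - r) ^ n)"
    using C \<open>s < r\<close> by (intro suminf_ennreal2) (auto intro!: summable_mult summable_geometric)
  finally show ?thesis using order_le_less_trans by fastforce
qed

text \<open>Independence factorizes the exponential moment of the sum into finite factors; Markov's
  inequality for the exponential of the sum does the rest.\<close>

lemma (in prob_space) chernoff_sum:
  fixes X :: "'i \<Rightarrow> 'a \<Rightarrow> real"
  assumes "finite I" and indep: "indep_vars (\<lambda>_. borel) X I" and "0 < s"
    and fin: "\<And>i. i \<in> I \<Longrightarrow> (\<integral>\<^sup>+ \<omega>. ennreal (exp (s * X i \<omega>)) \<partial>M) < \<infinity>"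
  shows "\<exists>B>0. \<forall>x. prob {\<omega> \<in> space M. (\<Sum>i\<in>I. X i \<omega>) > x} \<le> B * exp (- s * x)"
proof -
  have X[measurable]: "random_variable borel (X i)" if "i \<in> I" for i
    using indep that by (auto simp: indep_vars_def)
  let ?S = "\<lambda>\<omega>. \<Sum>i\<in>I. X i \<omega>"
  let ?E = "\<integral>\<^sup>+ \<omega>. ennreal (exp (s * ?S \<omega>)) \<partial>M"
  have "?E = (\<integral>\<^sup>+ \<omega>. (\<Prod>i\<in>I. ennreal (exp (s * X i \<omega>))) \<partial>M)"
    by (simp add: prod_ennreal sum_distrib_left exp_sum \<open>finite I\<close>)
  also have "\<dots> = (\<Prod>i\<in>I. \<integral>\<^sup>+ \<omega>. ennreal (exp (s * X i \<omega>)) \<partial>M)"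
    using \<open>finite I\<close> indep
    by (intro indep_vars_nn_integral indep_vars_compose2[OF indep]) auto
  also have "\<dots> < \<infinity>"
    using fin by (auto simp: less_top[symmetric] ennreal_prod_eq_top)
  finally have E: "?E < \<infinity>" .
  \<comment> \<open>The \<open>+ 1\<close> makes the constant positive without a separate argument
    that the moment is nonzero.\<close>
  have "prob {\<omega> \<in> space M. ?S \<omega> > x} \<le> (enn2real ?E + 1) * exp (- s * x)" for x
  proof -
    have "emeasure M {\<omega> \<in> space M. ?S \<omega> > x} \<le> emeasure M {\<omega> \<in> space M. ?S \<omega> \<ge> x}"
      by (intro emeasure_mono) auto
    also have "\<dots> \<le> ennreal (exp (- s * x)) *
        (\<integral>\<^sup>+ \<omega>. ennreal (exp (s * ?S \<omega>)) * indicator (space M) \<omega> \<partial>M)"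
      using \<open>0 < s\<close> by (intro Chernoff_ineq_nn_integral_ge) auto
    also have "(\<integral>\<^sup>+ \<omega>. ennreal (exp (s * ?S \<omega>)) * indicator (space M) \<omega> \<partial>M) = ?E"
      by (intro nn_integral_cong) simp
    also have "ennreal (exp (- s * x)) * ?E = ennreal (exp (- s * x) * enn2real ?E)"
      using E by (simp add: ennreal_mult)
    finally have "prob {\<omega> \<in> space M. ?S \<omega> > x} \<le> exp (- s * x) * enn2real ?E"
      by (simp add: emeasure_eq_measure)
    also have "\<dots> \<le> (enn2real ?E + 1) * exp (- s * x)"
      by (simp add: algebra_simps)
    finally show ?thesis .
  qed
  moreover have "enn2real ?E + 1 > 0"
    using enn2real_nonneg[of ?E] by linarith
  ultimately show ?thesis by blast
qed

section \<open>Convolution powers as laws of sums\<close>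

text \<open>This allows tails of \<open>conv_power\<close> to be read as probabilities of sums. In
  the induction the last variable is independent of the sum of the earlier ones; the empty sum is 0,
  whose law is the point mass \<open>conv_power 0\<close>.\<close>

lemma (in prob_space) distr_sum_eq_conv_power:
  fixes X :: "nat \<Rightarrow> 'a \<Rightarrow> real"
  assumes "indep_vars (\<lambda>_. borel) X {..<k}" "\<And>i. i < k \<Longrightarrow> distr M borel (X i) = N"
  shows "distr M borel (\<lambda>\<omega>. \<Sum>i<k. X i \<omega>) = conv_power k N"
  using assms
proof (induction k)
  case 0
  show ?case by (simp add: distr_const)
next
  case (Suc k)
  have rv: "random_variable borel (X i)" if "i < Suc k" for i
    using Suc.prems(1) that by (auto simp: indep_vars_def)
  have "indep_var borel (X k) borel (\<lambda>\<omega>. \<Sum>i\<in>{..<k}. X i \<omega>)"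
    using Suc.prems(1) by (intro indep_vars_sum) (auto simp: lessThan_Suc)
  then have "distr M borel (\<lambda>\<omega>. X k \<omega> + (\<Sum>i<k. X i \<omega>))
      = convolution (distr M borel (X k)) (distr M borel (\<lambda>\<omega>. \<Sum>i<k. X i \<omega>))"
    using rv by (intro sum_indep_random_variable) auto
  also have "distr M borel (\<lambda>\<omega>. \<Sum>i<k. X i \<omega>) = conv_power k N"
    using Suc.prems by (intro Suc.IH) (auto intro: indep_vars_subset)
  finally show ?case
    using Suc.prems(2)[of k] by (simp add: add.commute)
qed

lemma (in prob_space) tail_distr:
  assumes [measurable]: "random_variable borel Y"
  shows "tail (distr M borel Y) y = prob {\<omega> \<in> space M. Y \<omega> > y}"
proof -
  have "{\<omega> \<in> space M. Y \<omega> > y} = space M - {\<omega> \<in> space M. Y \<omega> \<le> y}" by auto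
  then have "prob {\<omega> \<in> space M. Y \<omega> > y} = 1 - prob {\<omega> \<in> space M. Y \<omega> \<le> y}"
    by (simp only: prob_compl) (subst prob_compl, auto)
  then show ?thesis
    by (simp add: tail_def cdf_def measure_distr vimage_def Int_def conj_commute)
qed

section \<open>Product densities and the geometry of large sums\<close>

text \<open>A product measure is determined by its values on boxes. There the indicator splits into
  coordinate factors, so the integral of the product density factorizes.\<close>

lemma density_PiM:
  fixes I :: "'i set" and f :: "'a \<Rightarrow> ennreal"
  assumes "finite I" "sigma_finite_measure N" "sigma_finite_measure (density N f)"
    and [measurable]: "f \<in> borel_measurable N"
  shows "density (\<Pi>\<^sub>M i\<in>I. N) (\<lambda>x. \<Prod>i\<in>I. f (x i)) = (\<Pi>\<^sub>M i\<in>I. density N f)"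
proof -
  interpret N: product_sigma_finite "\<lambda>_::'i. N"
    by (simp add: product_sigma_finite_def assms)
  interpret D: product_sigma_finite "\<lambda>_::'i. density N f"
    by (simp add: product_sigma_finite_def assms)
  show ?thesis
  proof (rule D.PiM_eqI)
    show "sets (density (\<Pi>\<^sub>M i\<in>I. N) (\<lambda>x. \<Prod>i\<in>I. f (x i))) = sets (\<Pi>\<^sub>M i\<in>I. density N f)"
      by (simp cong: sets_PiM_cong)
    fix A assume A: "\<And>i. i \<in> I \<Longrightarrow> A i \<in> sets (density N f)"
    then have [measurable]: "\<And>i. i \<in> I \<Longrightarrow> A i \<in> sets N" by simp
    have "emeasure (density (\<Pi>\<^sub>M i\<in>I. N) (\<lambda>x. \<Prod>i\<in>I. f (x i))) (Pi\<^sub>E I A)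
        = (\<integral>\<^sup>+ x. (\<Prod>i\<in>I. f (x i)) * indicator (Pi\<^sub>E I A) x \<partial>(\<Pi>\<^sub>M i\<in>I. N))"
      using \<open>finite I\<close> by (intro emeasure_density) (auto intro!: sets_PiM_I_finite)
    also have "\<dots> = (\<integral>\<^sup>+ x. (\<Prod>i\<in>I. f (x i) * indicator (A i) (x i)) \<partial>(\<Pi>\<^sub>M i\<in>I. N))"
      using \<open>finite I\<close>
      by (intro nn_integral_cong)
        (auto simp: prod.distrib indicator_def space_PiM PiE_iff prod_eq_1_iff split: if_splits)
    also have "\<dots> = (\<Prod>i\<in>I. \<integral>\<^sup>+ x. f x * indicator (A i) x \<partial>N)"
      using \<open>finite I\<close> by (intro N.product_nn_integral_prod) auto
    also have "\<dots> = (\<Prod>i\<in>I. emeasure (density N f) (A i))"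
      by (intro prod.cong) (auto simp: emeasure_density)
    finally show "emeasure (density (\<Pi>\<^sub>M i\<in>I. N) (\<lambda>x. \<Prod>i\<in>I. f (x i))) (Pi\<^sub>E I A)
        = (\<Prod>i\<in>I. emeasure (density N f) (A i))" .
  qed (fact assms)
qed

text \<open>If one coordinate exceeds \<gamma>, its term vanishes and each of the others is at most
  \<gamma>. If none does, the positive parts are the plain differences, which add up to
  \<open>card I * \<gamma> - sum x I\<close>.\<close>

lemma sum_max_diff_le:
  fixes x :: "'i \<Rightarrow> real"
  assumes "finite I" "\<And>i. i \<in> I \<Longrightarrow> x i \<ge> 0" "0 \<le> \<gamma>" "sum x I \<ge> \<gamma>"
  shows "(\<Sum>i\<in>I. max (\<gamma> - x i) 0) \<le> (real (card I) - 1) * \<gamma>"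
proof (cases "\<exists>j\<in>I. x j > \<gamma>")
  case True
  then obtain j where j: "j \<in> I" "x j > \<gamma>" by blast
  have "(\<Sum>i\<in>I. max (\<gamma> - x i) 0) = (\<Sum>i\<in>I - {j}. max (\<gamma> - x i) 0)"
    using j \<open>finite I\<close> by (simp add: sum.remove)
  also have "\<dots> \<le> (\<Sum>i\<in>I - {j}. \<gamma>)"
    using assms by (intro sum_mono) auto
  also have "\<dots> = (real (card I) - 1) * \<gamma>"
    using j \<open>finite I\<close> card_gt_0_iff[of I] by (subst sum_constant) (auto simp: of_nat_diff Suc_le_eq)
  finally show ?thesis .
next
  case False
  then have "(\<Sum>i\<in>I. max (\<gamma> - x i) 0) = (\<Sum>i\<in>I. \<gamma> - x i)"
    by (intro sum.cong) (auto simp: not_less)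
  also have "\<dots> = real (card I) * \<gamma> - sum x I"
    by (simp add: sum_subtractf)
  finally show ?thesis using assms(4) by (simp add: algebra_simps)
qed

section \<open>Regularity of tails and measurability of the estimator\<close>

lemma (in real_distribution) antimono_tail: "antimono (tail M)"
  by (auto simp: antimono_def tail_def intro: cdf_nondecreasing)

lemma (in real_distribution) tail_nonneg: "0 \<le> tail M x"
  by (simp add: tail_def cdf_bounded_prob)

lemma (in real_distribution) borel_measurable_tail [measurable]: "tail M \<in> borel_measurable borel"
proof -
  have [measurable]: "cdf M \<in> borel_measurable borel"
    by (intro borel_measurable_mono monoI cdf_nondecreasing)
  show ?thesis unfolding tail_def[abs_def] by measurable
qed

lemma real_distribution_conv_power:
  assumes "real_distribution N"
  shows "real_distribution (conv_power k N)"
proof (induction k)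
  case 0
  then show ?case
    by (auto simp: real_distribution_def real_distribution_axioms_def intro: prob_space_return)
next
  case (Suc k)
  interpret N: real_distribution N by fact
  interpret C: real_distribution "conv_power k N" by fact
  interpret P: pair_prob_space N "conv_power k N" ..
  have [measurable]: "(\<lambda>(x, y). x + y) \<in> borel_measurable (N \<Otimes>\<^sub>M conv_power k N)"
    by (simp cong: measurable_cong_sets sets_pair_measure_cong)
  show ?case
    by (auto simp: real_distribution_def real_distribution_axioms_def convolution_def
        intro!: P.prob_space_distr)
qed

lemma borel_measurable_is_density:
  assumes N: "real_distribution (jump_law f1)" and [measurable]: "f1 \<in> borel_measurable borel"
  shows "is_density f1 d \<gamma> \<in> borel_measurable (\<Pi>\<^sub>M i\<in>{..<d}. borel)"
proof -
  interpret C: real_distribution "conv_power (d - 1) (jump_law f1)"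
    using N by (rule real_distribution_conv_power)
  have [measurable]: "is_marginal f1 d \<gamma> \<in> borel_measurable borel"
    unfolding is_marginal_def[abs_def] using C.borel_measurable_tail by measurable
  show ?thesis unfolding is_density_def[abs_def] by measurable
qed

lemma borel_measurable_is_estimator:
  assumes N: "real_distribution (jump_law f1)" and f1[measurable]: "f1 \<in> borel_measurable borel"
  shows "is_estimator f1 d \<gamma> \<in> borel_measurable (\<Pi>\<^sub>M i\<in>{..<d}. borel)"
  unfolding is_estimator_def[abs_def]
  using borel_measurable_is_density[OF N f1, measurable] by measurable

section \<open>Change of measure and pointwise bound on the estimator\<close>

text \<open>One of the two factors \<open>Z\<close> absorbs the sampling density and leaves the
  product of the \<open>f1 (x i)\<close>. Both sides are \<open>ennreal\<close> integrals, so no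
  integrability has to be known.\<close>

lemma second_moment_eq_mean_estimator:
  assumes N: "real_distribution (jump_law f1)"
    and f1[measurable]: "f1 \<in> borel_measurable borel" and nonneg: "\<And>x. 0 \<le> f1 x"
  shows "is_second_moment f1 d \<gamma>
    = (\<integral>\<^sup>+ x. ennreal (is_estimator f1 d \<gamma> x) \<partial>(\<Pi>\<^sub>M i\<in>{..<d}. jump_law f1))"
proof -
  interpret N: real_distribution "jump_law f1" by fact
  have "0 \<le> tail (conv_power k (jump_law f1)) y" for k y
    using N by (intro real_distribution.tail_nonneg real_distribution_conv_power)
  then have "0 \<le> is_marginal f1 d \<gamma> x" for x
    by (simp add: is_marginal_def nonneg)
  then have g: "0 \<le> is_density f1 d \<gamma> x" for x
    by (simp add: is_density_def prod_nonneg)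
  have sets_eq: "sets (\<Pi>\<^sub>M i\<in>{..<d}. lborel) = sets (\<Pi>\<^sub>M i\<in>{..<d}. borel :: real measure)"
    by (intro sets_PiM_cong) auto
  have [measurable]: "is_density f1 d \<gamma> \<in> borel_measurable (\<Pi>\<^sub>M i\<in>{..<d}. lborel)"
      "is_estimator f1 d \<gamma> \<in> borel_measurable (\<Pi>\<^sub>M i\<in>{..<d}. lborel)"
    using borel_measurable_is_density[OF N f1] borel_measurable_is_estimator[OF N f1]
    by (simp_all cong: measurable_cong_sets add: measurable_cong_sets[OF sets_eq refl])
  have est: "0 \<le> is_estimator f1 d \<gamma> x" for x
    by (simp add: is_estimator_def g nonneg prod_nonneg)
  \<comment> \<open>Where \<open>g\<close> vanishes both sides are \<open>0\<close>, because division by \<open>0\<close> makes \<open>Z\<close> vanish there.\<close>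
  have swap: "is_density f1 d \<gamma> x * (is_estimator f1 d \<gamma> x)\<^sup>2
      = (\<Prod>i<d. f1 (x i)) * is_estimator f1 d \<gamma> x" for x
    by (simp add: is_estimator_def power2_eq_square)
  have "is_second_moment f1 d \<gamma>
      = (\<integral>\<^sup>+ x. ennreal (is_density f1 d \<gamma> x) * ennreal ((is_estimator f1 d \<gamma> x)\<^sup>2)
          \<partial>(\<Pi>\<^sub>M i\<in>{..<d}. lborel))"
    unfolding is_second_moment_def is_law_def by (intro nn_integral_density) auto
  also have "\<dots> = (\<integral>\<^sup>+ x. (\<Prod>i<d. ennreal (f1 (x i))) * ennreal (is_estimator f1 d \<gamma> x)
          \<partial>(\<Pi>\<^sub>M i\<in>{..<d}. lborel))"
    by (simp add: g est nonneg swap prod_ennreal prod_nonneg flip: ennreal_mult)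
  also have "\<dots> = (\<integral>\<^sup>+ x. ennreal (is_estimator f1 d \<gamma> x)
          \<partial>density (\<Pi>\<^sub>M i\<in>{..<d}. lborel) (\<lambda>x. \<Prod>i<d. ennreal (f1 (x i))))"
    by (intro nn_integral_density[symmetric]) auto
  also have "density (\<Pi>\<^sub>M i\<in>{..<d}. lborel) (\<lambda>x. \<Prod>i<d. ennreal (f1 (x i)))
      = (\<Pi>\<^sub>M i\<in>{..<d}. jump_law f1)"
    unfolding jump_law_def
    by (intro density_PiM)
      (auto intro: lborel.sigma_finite_measure_axioms
        N.sigma_finite_measure_axioms[unfolded jump_law_def])
  finally show ?thesis .
qed

text \<open>The likelihood ratio is a product over coordinates, so the exponents
  \<open>max (\<gamma> - x i) 0\<close> add up and \<open>sum_max_diff_le\<close> applies. The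
  \<open>max\<close> in \<open>lower\<close> extends an exponential bound on the half-line to
  negative arguments.\<close>

lemma is_estimator_le:
  fixes x :: "nat \<Rightarrow> real"
  assumes nonneg: "\<And>x. 0 \<le> f1 x" and "0 < c" "0 < r" "0 \<le> \<gamma>" and x: "\<And>i. i < d \<Longrightarrow> 0 \<le> x i"
    and lower: "\<And>y. c * exp (- r * max y 0) \<le> tail (conv_power (d - 1) (jump_law f1)) y"
    and l: "0 \<le> tail (conv_power d (jump_law f1)) \<gamma>"
    and sum: "(\<Sum>i<d. x i) > \<gamma>"
  shows "is_estimator f1 d \<gamma> x
    \<le> (tail (conv_power d (jump_law f1)) \<gamma> / c) ^ d * exp (r * (real d - 1) * \<gamma>)"
proof -
  let ?l = "tail (conv_power d (jump_law f1)) \<gamma>"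
  let ?T = "tail (conv_power (d - 1) (jump_law f1))"
  have "is_estimator f1 d \<gamma> x = (\<Prod>i<d. f1 (x i) / is_marginal f1 d \<gamma> (x i))"
    using sum by (simp add: is_estimator_def is_density_def prod_dividef)
  also have "\<dots> \<le> (\<Prod>i<d. ?l / c * exp (r * max (\<gamma> - x i) 0))"
  proof (rule prod_mono, rule conjI)
    fix i
    have pos: "0 < c * exp (- r * max (\<gamma> - x i) 0)" using \<open>0 < c\<close> by simp
    then have T: "0 < ?T (\<gamma> - x i)" using lower by (rule less_le_trans)
    show "0 \<le> f1 (x i) / is_marginal f1 d \<gamma> (x i)"
      using T l nonneg by (simp add: is_marginal_def)
    \<comment> \<open>Only an inequality: where \<open>f1 (x i)\<close> is 0 the left side is 0 by
      the convention for division by 0.\<close>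
    have "f1 (x i) / is_marginal f1 d \<gamma> (x i) \<le> ?l / ?T (\<gamma> - x i)"
      using T l nonneg[of "x i"] by (simp add: is_marginal_def)
    also have "\<dots> \<le> ?l / (c * exp (- r * max (\<gamma> - x i) 0))"
      using T l pos lower by (intro divide_left_mono) auto
    also have "\<dots> = ?l / c * exp (r * max (\<gamma> - x i) 0)"
      by (simp only: mult_minus_left exp_minus divide_inverse inverse_mult_distrib
          inverse_inverse_eq mult.assoc)
    finally show "f1 (x i) / is_marginal f1 d \<gamma> (x i) \<le> ?l / c * exp (r * max (\<gamma> - x i) 0)" .
  qed
  also have "\<dots> = (?l / c) ^ d * exp (r * (\<Sum>i<d. max (\<gamma> - x i) 0))"
    by (simp only: prod.distrib prod_constant card_lessThan sum_distrib_left)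
      (simp add: exp_sum)
  also have "\<dots> \<le> (?l / c) ^ d * exp (r * ((real d - 1) * \<gamma>))"
    using sum_max_diff_le[of "{..<d}" x \<gamma>] x sum \<open>0 \<le> \<gamma>\<close> \<open>0 < r\<close> l \<open>0 < c\<close>
    by (intro mult_left_mono) auto
  finally show ?thesis by (simp add: mult.assoc)
qed

section \<open>Logarithmic efficiency\<close>

text \<open>In \<open>assumption_A\<close> the boundedness condition makes \<open>sup_ratio\<close>
  a genuine supremum; restricting the class of \<open>h\<close> only weakens the hypothesis. The
  quotient in the conclusion is an \<open>ennreal\<close>, so an infinite second moment would not be
  hidden.\<close>

theorem proposition3:
  fixes M :: "'a measure" and X :: "nat \<Rightarrow> 'a \<Rightarrow> real"
    and f1 :: "real \<Rightarrow> real" and d :: nat and \<theta> :: real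
  assumes "prob_space M"
    and "d \<ge> 2"
    and "prob_space.indep_vars M (\<lambda>_. borel) X {..<d}"
    and "\<forall>x. f1 x \<ge> 0"
    and "\<forall>i<d. distributed M lborel (X i) (\<lambda>x. ennreal (f1 x))"
    and "\<forall>i<d. AE \<omega> in M. X i \<omega> > 0"
    and "\<forall>x. tail (jump_law f1) x > 0"
    and "\<theta> > 0"
    and "embrechts_goldie \<theta> (jump_law f1)"
    and assumption_A:
      "\<forall>h::real \<Rightarrow> real.
         h \<in> borel_measurable borel \<and> long_tailed h \<and> (\<forall>x\<ge>0. h x > 0) \<and>
         (\<forall>\<gamma>\<ge>0. bdd_above ((\<lambda>x. h \<gamma> / h x) ` {0..\<gamma>})) \<longrightarrow>
         (\<forall>\<epsilon>>0. sup_ratio h \<in> o(\<lambda>\<gamma>. exp (\<epsilon> * \<gamma>)))"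
  shows "\<forall>\<epsilon>>0. ((\<lambda>\<gamma>. is_second_moment f1 d \<gamma> /
            ennreal (measure M {\<omega> \<in> space M. (\<Sum>i<d. X i \<omega>) > \<gamma>} powr (2 - \<epsilon>))) \<longlongrightarrow> 0) at_top"
proof (intro allI impI)
  fix \<epsilon> :: real assume "\<epsilon> > 0"
  interpret prob_space M by fact
  let ?N = "jump_law f1"
  define S where "S k \<omega> = (\<Sum>i<k. X i \<omega>)" for k \<omega>
  define l where "l \<gamma> = prob {\<omega> \<in> space M. S d \<omega> > \<gamma>}" for \<gamma>
  have X[measurable]: "random_variable borel (X i)" if "i < d" for i
    using assms(3) that by (auto simp: indep_vars_def)
  have S[measurable]: "random_variable borel (S k)" if "k \<le> d" for k
    using that unfolding S_def by (intro borel_measurable_sum X) auto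
  have distr_X: "distr M borel (X i) = ?N" if "i < d" for i
  proof -
    have "distr M lborel (X i) = ?N"
      using assms(5) that unfolding jump_law_def by (intro distributed_distr_eq_density) auto
    then show ?thesis by (simp cong: distr_cong)
  qed
  have tail_X: "tail ?N y = prob {\<omega> \<in> space M. X i \<omega> > y}" if "i < d" for i y
    using tail_distr[OF X[OF that], of y] distr_X[OF that] by simp
  have tail_S: "tail (conv_power k ?N) y = prob {\<omega> \<in> space M. S k \<omega> > y}" if "k \<le> d" for k y
  proof -
    have "distr M borel (S k) = conv_power k ?N"
      unfolding S_def using assms(3) that distr_X
      by (intro distr_sum_eq_conv_power) (auto intro: indep_vars_subset)
    then show ?thesis using tail_distr[OF S[OF that], of y] by simp
  qed
  have nonneg: "0 \<le> f1 x" for x using assms(4) by blast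
  have f1[measurable]: "f1 \<in> borel_measurable borel"
  proof -
    have "(\<lambda>x. ennreal (f1 x)) \<in> borel_measurable lborel"
      using assms(2,5) by (intro distributed_borel_measurable[of M lborel "X 0"]) simp
    \<comment> \<open>Measurability is known only for the \<open>ennreal\<close> version of the
      density; as \<open>f1\<close> is nonnegative, \<open>enn2real\<close> recovers it.\<close>
    then have "(\<lambda>x. enn2real (ennreal (f1 x))) \<in> borel_measurable borel"
      by measurable
    then show ?thesis by (simp add: nonneg)
  qed
  have N: "real_distribution ?N"
    using distr_X[of 0] X[of 0] assms(2) real_distribution_distr[of "X 0"] by simp
  interpret N: real_distribution ?N by fact
  have posX: "AE \<omega> in M. \<forall>i\<in>{..<d}. X i \<omega> > 0"
    using assms(6) by (intro AE_finite_allI) auto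
  \<comment> \<open>Positive jumps give \<open>X 0 \<le> S k\<close> almost surely. The case
    \<open>k = d\<close> makes \<open>l\<close> positive; \<open>k = d - 1\<close>, admissible as
    \<open>d \<ge> 2\<close>, bounds the denominators of the estimator from below.\<close>
  have tail_le: "tail ?N y \<le> prob {\<omega> \<in> space M. S k \<omega> > y}" if "1 \<le> k" "k \<le> d" for k y
  proof -
    have "prob {\<omega> \<in> space M. X 0 \<omega> > y} \<le> prob {\<omega> \<in> space M. S k \<omega> > y}"
    proof (rule finite_measure_mono_AE)
      show "AE \<omega> in M. \<omega> \<in> {\<omega> \<in> space M. X 0 \<omega> > y} \<longrightarrow> \<omega> \<in> {\<omega> \<in> space M. S k \<omega> > y}"
        using posX
      proof eventually_elim
        case (elim \<omega>)
        have "X 0 \<omega> \<le> S k \<omega>"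
          unfolding S_def using elim that
          by (intro member_le_sum) (auto intro!: less_imp_le)
        then show ?case by auto
      qed
    qed (use that in measurable)
    then show ?thesis using tail_X[of 0 y] assms(2) by simp
  qed
  have l_pos: "0 < l \<gamma>" for \<gamma>
    using less_le_trans[OF _ tail_le[of d \<gamma>]] assms(2,7) by (simp add: l_def)

  have lim: "((\<lambda>x. tail ?N (x + 1) / tail ?N x) \<longlongrightarrow> exp (- \<theta>)) at_top"
    using assms(9) unfolding embrechts_goldie_def by (auto dest: spec[of _ 1])
  have pos: "tail ?N x > 0" for x using assms(7) by blast

  \<comment> \<open>The final exponent is \<open>(\<theta> + \<delta>) * (d - 1) - (\<theta> -
    \<delta>) * (d - 1 + \<epsilon>) = \<delta> * D - \<theta> * \<epsilon>\<close>. The choice of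
    \<delta> spends half of \<open>\<theta> * \<epsilon>\<close>, and
    \<open>\<epsilon> \<le> D\<close> keeps \<delta> below \<theta>.\<close>
  define D where "D = 2 * (real d - 1) + \<epsilon>"
  define \<delta> where "\<delta> = \<theta> * \<epsilon> / (2 * D)"
  have D: "\<epsilon> \<le> D" "0 < D" using assms(2) \<open>\<epsilon> > 0\<close> by (auto simp: D_def)
  have \<delta>: "0 < \<delta>" "\<delta> < \<theta>" using D assms(8) \<open>\<epsilon> > 0\<close> by (auto simp: \<delta>_def field_simps)
  have \<delta>D: "\<delta> * D = \<theta> * \<epsilon> / 2" using D by (simp add: \<delta>_def)

  obtain c where c: "c > 0" "\<And>x. x \<ge> 0 \<Longrightarrow> c * exp (- (\<theta> + \<delta>) * x) \<le> tail ?N x"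
    using exponential_lower_bound[OF N.antimono_tail pos lim, of "\<theta> + \<delta>"] \<delta> assms(8) by auto
  \<comment> \<open>The rate \<open>\<theta> - \<delta> / 2\<close> lies strictly above
    \<open>\<theta> - \<delta>\<close>, which leaves the gap that makes the exponential moment at
    \<open>\<theta> - \<delta>\<close> finite.\<close>
  obtain C where C: "\<And>x. x \<ge> 0 \<Longrightarrow> tail ?N x \<le> C * exp (- (\<theta> - \<delta> / 2) * x)"
    using exponential_upper_bound[OF N.antimono_tail pos lim, of "\<theta> - \<delta> / 2"] \<delta> by auto
  have "(\<integral>\<^sup>+ \<omega>. ennreal (exp ((\<theta> - \<delta>) * X i \<omega>)) \<partial>M) < \<infinity>" if "i < d" for i
  proof (rule exponential_moment_finite[where r = "\<theta> - \<delta> / 2" and C = C])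
    show "prob {\<omega> \<in> space M. X i \<omega> > x} \<le> C * exp (- (\<theta> - \<delta> / 2) * x)" if "0 \<le> x" for x
      using C[OF that] tail_X[OF \<open>i < d\<close>] by simp
  qed (use that assms(6) \<delta> in simp_all)
  then have "\<exists>B>0. \<forall>x. prob {\<omega> \<in> space M. (\<Sum>i<d. X i \<omega>) > x} \<le> B * exp (- (\<theta> - \<delta>) * x)"
    using \<delta> by (intro chernoff_sum assms(3)) auto
  then obtain B where B: "B > 0" "\<And>x. l x \<le> B * exp (- (\<theta> - \<delta>) * x)"
    by (auto simp: l_def S_def)

  have lower: "c * exp (- (\<theta> + \<delta>) * max y 0) \<le> tail (conv_power (d - 1) ?N) y" for y
  proof -
    have "c * exp (- (\<theta> + \<delta>) * max y 0) \<le> tail ?N (max y 0)" by (rule c) simp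
    also have "\<dots> \<le> tail ?N y" by (intro antimonoD[OF N.antimono_tail]) simp
    also have "\<dots> \<le> tail (conv_power (d - 1) ?N) y"
      using tail_le[of "d - 1" y] tail_S[of "d - 1" y] assms(2) by simp
    finally show ?thesis .
  qed

  have moment: "is_second_moment f1 d \<gamma>
      \<le> ennreal ((l \<gamma> / c) ^ d * exp ((\<theta> + \<delta>) * (real d - 1) * \<gamma>) * l \<gamma>)" if "\<gamma> \<ge> 0" for \<gamma>
  proof -
    let ?K = "(l \<gamma> / c) ^ d * exp ((\<theta> + \<delta>) * (real d - 1) * \<gamma>)"
    have ld: "tail (conv_power d ?N) \<gamma> = l \<gamma>" using tail_S[of d \<gamma>] by (simp add: l_def)
    have K: "0 \<le> ?K" using c l_pos[of \<gamma>] by simp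
    \<comment> \<open>The vector is restricted to the index set because points of the product space
      are extensional functions.\<close>
    let ?X = "\<lambda>\<omega>. \<lambda>i\<in>{..<d}. X i \<omega>"
    have joint: "(\<Pi>\<^sub>M i\<in>{..<d}. ?N) = distr M (\<Pi>\<^sub>M i\<in>{..<d}. borel) ?X"
    proof -
      have "distr M (\<Pi>\<^sub>M i\<in>{..<d}. borel) ?X = (\<Pi>\<^sub>M i\<in>{..<d}. distr M borel (X i))"
        using assms(2,3) X by (subst indep_vars_iff_distr_eq_PiM'[symmetric]) (auto simp: lessThan_empty_iff)
      also have "\<dots> = (\<Pi>\<^sub>M i\<in>{..<d}. ?N)"
        by (intro PiM_cong) (auto simp: distr_X)
      finally show ?thesis by simp
    qed
    have "is_second_moment f1 d \<gamma>
        = (\<integral>\<^sup>+ x. ennreal (is_estimator f1 d \<gamma> x) \<partial>(\<Pi>\<^sub>M i\<in>{..<d}. ?N))"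
      using N f1 nonneg by (rule second_moment_eq_mean_estimator)
    also have "\<dots> = (\<integral>\<^sup>+ \<omega>. ennreal (is_estimator f1 d \<gamma> (?X \<omega>)) \<partial>M)"
      unfolding joint
      using borel_measurable_is_estimator[OF N f1, of d \<gamma>, measurable]
      by (intro nn_integral_distr measurable_restrict X) auto
    \<comment> \<open>Keeping the indicator of the event \<open>S d > \<gamma>\<close>, outside
      which the estimator is 0, yields one more factor \<open>l \<gamma>\<close> beyond the
      \<open>d\<close> factors inside \<open>?K\<close>.\<close>
    also have "\<dots> \<le> (\<integral>\<^sup>+ \<omega>. ennreal ?K * indicator {\<omega> \<in> space M. S d \<omega> > \<gamma>} \<omega> \<partial>M)"
    proof (rule nn_integral_mono_AE, use posX AE_space in eventually_elim)
      fix \<omega> assume \<omega>: "\<forall>i\<in>{..<d}. 0 < X i \<omega>" "\<omega> \<in> space M"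
      have sum_eq: "(\<Sum>i<d. ?X \<omega> i) = S d \<omega>" by (simp add: S_def)
      show "ennreal (is_estimator f1 d \<gamma> (?X \<omega>))
          \<le> ennreal ?K * indicator {\<omega> \<in> space M. S d \<omega> > \<gamma>} \<omega>"
      proof (cases "S d \<omega> > \<gamma>")
        case True
        have "is_estimator f1 d \<gamma> (?X \<omega>)
            \<le> (tail (conv_power d ?N) \<gamma> / c) ^ d * exp ((\<theta> + \<delta>) * (real d - 1) * \<gamma>)"
        proof (rule is_estimator_le[OF nonneg c(1) _ that _ lower])
          show "0 < \<theta> + \<delta>" using \<delta> assms(8) by simp
          show "0 \<le> ?X \<omega> i" if "i < d" for i using \<omega>(1) that by (simp add: less_imp_le)
          show "0 \<le> tail (conv_power d ?N) \<gamma>" using l_pos[of \<gamma>] ld by simp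
          show "\<gamma> < (\<Sum>i<d. ?X \<omega> i)" using True sum_eq by simp
        qed
        then show ?thesis using True \<omega>(2) by (simp add: ld ennreal_leI)
      next
        case False
        then show ?thesis using sum_eq by (simp add: is_estimator_def)
      qed
    qed
    also have "\<dots> = ennreal ?K * emeasure M {\<omega> \<in> space M. S d \<omega> > \<gamma>}"
      by (intro nn_integral_cmult_indicator) simp
    also have "\<dots> = ennreal (?K * l \<gamma>)"
      using K by (simp add: emeasure_eq_measure l_def flip: ennreal_mult)
    finally show ?thesis .
  qed

  define A where "A = (1 / c) ^ d * B powr (real d - 1 + \<epsilon>)"
  have bound: "is_second_moment f1 d \<gamma> / ennreal (l \<gamma> powr (2 - \<epsilon>))
      \<le> ennreal (A * exp (- (\<theta> * \<epsilon> / 2) * \<gamma>))" if "\<gamma> \<ge> 0" for \<gamma>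
  proof -
    let ?E = "exp ((\<theta> + \<delta>) * (real d - 1) * \<gamma>)"
    \<comment> \<open>This is the power of \<open>l\<close> left after the division,
      \<open>d + 1 - (2 - \<epsilon>)\<close>. Being nonnegative, it lets the Chernoff bound be
      inserted for \<open>l\<close>.\<close>
    have e: "0 \<le> real d - 1 + \<epsilon>" using assms(2) \<open>\<epsilon> > 0\<close> by simp
    have "is_second_moment f1 d \<gamma> / ennreal (l \<gamma> powr (2 - \<epsilon>))
        \<le> ennreal ((l \<gamma> / c) ^ d * ?E * l \<gamma>) / ennreal (l \<gamma> powr (2 - \<epsilon>))"
      using moment[OF that] by (rule divide_right_mono_ennreal)
    also have "\<dots> = ennreal ((l \<gamma> / c) ^ d * ?E * l \<gamma> / l \<gamma> powr (2 - \<epsilon>))"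
      using l_pos[of \<gamma>] c(1) by (intro divide_ennreal) auto
    also have "(l \<gamma> / c) ^ d * ?E * l \<gamma> / l \<gamma> powr (2 - \<epsilon>)
        = (1 / c) ^ d * ?E * (l \<gamma> ^ d * l \<gamma> / l \<gamma> powr (2 - \<epsilon>))"
      by (simp add: power_divide)
    also have "l \<gamma> ^ d * l \<gamma> / l \<gamma> powr (2 - \<epsilon>) = l \<gamma> powr (real d - 1 + \<epsilon>)"
    proof -
      have "l \<gamma> ^ d * l \<gamma> = l \<gamma> powr (real d + 1)"
        using l_pos[of \<gamma>] by (simp add: powr_add powr_realpow)
      then show ?thesis by (simp add: algebra_simps flip: powr_diff)
    qed
    also have "(1 / c) ^ d * ?E * l \<gamma> powr (real d - 1 + \<epsilon>)
        \<le> (1 / c) ^ d * ?E * (B * exp (- (\<theta> - \<delta>) * \<gamma>)) powr (real d - 1 + \<epsilon>)"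
      using c(1) e l_pos[of \<gamma>] B(2)[of \<gamma>] by (intro mult_left_mono powr_mono2) auto
    also have "\<dots> = A * (?E * exp (- (\<theta> - \<delta>) * \<gamma> * (real d - 1 + \<epsilon>)))"
      using B(1) by (simp add: A_def powr_mult exp_powr_real)
    also have "?E * exp (- (\<theta> - \<delta>) * \<gamma> * (real d - 1 + \<epsilon>)) = exp ((\<delta> * D - \<theta> * \<epsilon>) * \<gamma>)"
      by (simp add: D_def algebra_simps flip: exp_add)
    also have "(\<delta> * D - \<theta> * \<epsilon>) * \<gamma> = - (\<theta> * \<epsilon> / 2) * \<gamma>"
      unfolding \<delta>D by simp
    finally show ?thesis by (auto simp: ennreal_leI)
  qed
  have "((\<lambda>\<gamma>. A * exp (- (\<theta> * \<epsilon> / 2) * \<gamma>)) \<longlongrightarrow> 0) at_top"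
    using assms(8) \<open>\<epsilon> > 0\<close> by real_asymp
  then have "((\<lambda>\<gamma>. ennreal (A * exp (- (\<theta> * \<epsilon> / 2) * \<gamma>))) \<longlongrightarrow> 0) at_top"
    using tendsto_ennrealI by fastforce
  then have "((\<lambda>\<gamma>. is_second_moment f1 d \<gamma> / ennreal (l \<gamma> powr (2 - \<epsilon>))) \<longlongrightarrow> 0) at_top"
  proof (rule tendsto_sandwich[OF _ _ tendsto_const, rotated 2])
    show "\<forall>\<^sub>F \<gamma> in at_top. is_second_moment f1 d \<gamma> / ennreal (l \<gamma> powr (2 - \<epsilon>))
        \<le> ennreal (A * exp (- (\<theta> * \<epsilon> / 2) * \<gamma>))"
      using eventually_ge_at_top[of 0] by eventually_elim (rule bound)
  qed simp
  then show "((\<lambda>\<gamma>. is_second_moment f1 d \<gamma> /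
      ennreal (prob {\<omega> \<in> space M. (\<Sum>i<d. X i \<omega>) > \<gamma>} powr (2 - \<epsilon>))) \<longlongrightarrow> 0) at_top"
    by (simp add: l_def S_def)
qed

end
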